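(* Quantum CD-categories and ICD-categories are equivalent kinds of structures. More precisely, to any quantum CD-category $\mathsf C'$ one can associate an ICD-category $J(\mathsf C')$ by restricting to even morphisms and considering the involution $$\overline{\phi}:=*_B\,\phi\,*_A$$ for every (even) morphism $\phi\colon A\to B$. Conversely, there is a construction $\mathsf C\mapsto Q(\mathsf C)$ turning every ICD-category $\mathsf C$ into a quantum CD-category $Q(\mathsf C)$ such that: (i) $JQ(\mathsf C)=\mathsf C$ for every ICD-category $\mathsf C$; (ii) $QJ(\mathsf C')$ is canonically strictly monoidally isomorphic to $\mathsf C'$ for any quantum CD-category $\mathsf C'$. Furthermore, the constructions $J$ and $Q$ are mutually inverse (in the sense of (i) and (ii)).
   Context: **ICD-categories.** A hom-involutive symmetric monoidal category is a symmetric monoidal category $(\mathsf C,\odot,I)$ with a strict symmetric monoidal endofunctor $\phi\mapsto\overline\phi$ (the involution) that is the identity on objects and whose square is the identity functor. An ICD-category is such a $\mathsf C$ in which every object $A$ comes with morphisms $\mathrm{copy}_A\colon A\to A\odot A$ and $\mathrm{del}_A\colon A\to I$ such that (suppressing coherence isomorphisms): (1) $(\mathrm{copy}_A\odot\mathrm{id})\mathrm{copy}_A=(\mathrm{id}\odot\mathrm{copy}_A)\mathrm{copy}_A$ and $(\mathrm{del}_A\odot\mathrm{id})\mathrm{copy}_A=\mathrm{id}_A=(\mathrm{id}\odot\mathrm{del}_A)\mathrm{copy}_A$; (2) $\overline{\mathrm{copy}_A}=\mathrm{swap}_{A,A}\,\mathrm{copy}_A$ and $\overline{\mathrm{del}_A}=\mathrm{del}_A$;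 (3) $\mathrm{copy}_{A\odot B}=(\mathrm{id}_A\odot\mathrm{swap}_{A,B}\odot\mathrm{id}_B)(\mathrm{copy}_A\odot\mathrm{copy}_B)$, $\mathrm{del}_{A\odot B}=\mathrm{del}_A\odot\mathrm{del}_B$, $\mathrm{del}_I=\mathrm{id}_I$, $\mathrm{copy}_I=\mathrm{id}_I$ (up to $I\cong I\odot I$). **Quantum CD-categories** (Parzygnat). A $\mathbb Z_2$-graded symmetric monoidal category is a category in which each hom-set is a disjoint union of even and odd morphisms, identities are even and parity is additive under composition, together with a symmetric monoidal structure in which the tensor product of two morphisms is defined only when they have the same parity (the result then having this parity), satisfying the interchange law, with even coherence isomorphisms (associators, unitors, swaps) that satisfy the usual coherence equations and are natural with respect to families of morphisms of common parity. A quantum CD-category is a $\mathbb Z_2$-graded symmetric monoidal category in which each object $A$ comes with even morphisms $\mathrm{copy}_A\colon A\to A\odot A$, $\mathrm{del}_A\colon A\to I$ and an odd morphism $*_A\colon A\to A$ such that: (QCD1) the comonoid equations in (1) hold, and $\mathrm{copy}_A\,*_A=\mathrm{swap}_{A,A}\,( *_A\odot *_A)\,\mathrm{copy}_A$; (QCD2) the equations in (3) hold; (QCD3) $*_A\,*_A=\mathrm{id}_A$, $*_{A\odot B}=*_A\odot *_B$, and $\mathrm{del}_A\,*_A=*_I\,\mathrm{del}_A$. The copy and delete morphisms, as well as the symmetric monoidal structure, of $J(\mathsf C')$ are those of $\mathsf C'$. *)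

theory Defs
  imports "HOL-Library.Z2" "HOL-Library.FuncSet"
begin

text \<open>
  A category is given by a set of objects and a set of arrows with domain and codomain.  All
  operations are partial; the axioms below require them to have the value \<^term>\<open>undefined\<close> outside
  their mathematical domain, so that two records are equal if and only if they describe the same
  structure, and \<open>=\<close> between records is equality of categories.

  Directions: \<open>Assoc A B E : (A \<otimes> B) \<otimes> E \<rightarrow> A \<otimes> (B \<otimes> E)\<close>, \<open>Lunit A : I \<otimes> A \<rightarrow> A\<close>,
  \<open>Runit A : A \<otimes> I \<rightarrow> A\<close>, \<open>Swap A B : A \<otimes> B \<rightarrow> B \<otimes> A\<close>.  The tensor is written \<open>\<otimes>\<close> on objects
  and \<open>\<odot>\<close> on arrows.
\<close>

record ('o, 'm) cd_data =
  Ob :: "'o set"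
  Arr :: "'m set"
  Dom :: "'m \<Rightarrow> 'o"
  Cod :: "'m \<Rightarrow> 'o"
  Id :: "'o \<Rightarrow> 'm"
  Comp :: "'m \<Rightarrow> 'm \<Rightarrow> 'm"  (infixl "\<cdot>\<index>" 70)
  TenO :: "'o \<Rightarrow> 'o \<Rightarrow> 'o"  (infixr "\<otimes>\<index>" 75)
  TenA :: "'m \<Rightarrow> 'm \<Rightarrow> 'm"  (infixr "\<odot>\<index>" 75)
  Unit :: "'o"
  Assoc :: "'o \<Rightarrow> 'o \<Rightarrow> 'o \<Rightarrow> 'm"
  Lunit :: "'o \<Rightarrow> 'm"
  Runit :: "'o \<Rightarrow> 'm"
  Swap :: "'o \<Rightarrow> 'o \<Rightarrow> 'm"
  Copy :: "'o \<Rightarrow> 'm"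
  Del :: "'o \<Rightarrow> 'm"

definition hom :: "('o, 'm, 'x) cd_data_scheme \<Rightarrow> 'o \<Rightarrow> 'o \<Rightarrow> 'm set" where
  "hom C A B = {f \<in> Arr C. Dom C f = A \<and> Cod C f = B}"

definition inverse_arrows :: "('o, 'm, 'x) cd_data_scheme \<Rightarrow> 'm \<Rightarrow> 'm \<Rightarrow> bool" where
  "inverse_arrows C f g \<longleftrightarrow>
     f \<in> Arr C \<and> g \<in> hom C (Cod C f) (Dom C f) \<and>
     g \<cdot>\<^bsub>C\<^esub> f = Id C (Dom C f) \<and> f \<cdot>\<^bsub>C\<^esub> g = Id C (Cod C f)"

definition is_iso :: "('o, 'm, 'x) cd_data_scheme \<Rightarrow> 'm \<Rightarrow> bool" where
  "is_iso C f \<longleftrightarrow> (\<exists>g. inverse_arrows C f g)"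

definition Inverse :: "('o, 'm, 'x) cd_data_scheme \<Rightarrow> 'm \<Rightarrow> 'm" where
  "Inverse C f = (THE g. inverse_arrows C f g)"

locale category =
  fixes C :: "('o, 'm, 'x) cd_data_scheme" (structure)
  assumes Dom_closed: "f \<in> Arr C \<Longrightarrow> Dom C f \<in> Ob C"
    and Cod_closed: "f \<in> Arr C \<Longrightarrow> Cod C f \<in> Ob C"
    and Id_hom: "A \<in> Ob C \<Longrightarrow> Id C A \<in> hom C A A"
    and Comp_hom: "f \<in> hom C A B \<Longrightarrow> g \<in> hom C B E \<Longrightarrow> g \<cdot> f \<in> hom C A E"
    and Comp_Id_left: "f \<in> hom C A B \<Longrightarrow> Id C B \<cdot> f = f"
    and Comp_Id_right: "f \<in> hom C A B \<Longrightarrow> f \<cdot> Id C A = f"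
    and Comp_assoc:
      "f \<in> hom C A B \<Longrightarrow> g \<in> hom C B E \<Longrightarrow> h \<in> hom C E F \<Longrightarrow> (h \<cdot> g) \<cdot> f = h \<cdot> (g \<cdot> f)"
    and Dom_undefined: "f \<notin> Arr C \<Longrightarrow> Dom C f = undefined"
    and Cod_undefined: "f \<notin> Arr C \<Longrightarrow> Cod C f = undefined"
    and Id_undefined: "A \<notin> Ob C \<Longrightarrow> Id C A = undefined"
    and Comp_undefined:
      "\<not> (f \<in> Arr C \<and> g \<in> Arr C \<and> Cod C f = Dom C g) \<Longrightarrow> g \<cdot> f = undefined"

text \<open>
  \<open>par\<close> assigns to each arrow its parity.  If \<open>par\<close> is constantly \<open>0\<close> (all arrows are even), then
  every condition on parities is void and what remains are the axioms of an ordinary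
  symmetric monoidal category; \<open>icd_category\<close> uses the locale in this way.

  The unitors are natural only with respect to even arrows: the unit object carries the even arrow
  \<open>Id C Unit\<close>, which has no tensor product with an odd arrow.
\<close>

locale graded_symmetric_monoidal_category = category C
  for C :: "('o, 'm, 'x) cd_data_scheme" (structure) +
  fixes par :: "'m \<Rightarrow> bit"
  assumes par_Id: "A \<in> Ob C \<Longrightarrow> par (Id C A) = 0"
    and par_Comp: "f \<in> hom C A B \<Longrightarrow> g \<in> hom C B E \<Longrightarrow> par (g \<cdot> f) = par g + par f"
    and Unit_closed: "Unit C \<in> Ob C"
    and TenO_closed: "A \<in> Ob C \<Longrightarrow> B \<in> Ob C \<Longrightarrow> A \<otimes> B \<in> Ob C"
    and TenA_hom:
      "f \<in> hom C A B \<Longrightarrow> g \<in> hom C A' B' \<Longrightarrow> par f = par g \<Longrightarrow>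
         f \<odot> g \<in> hom C (A \<otimes> A') (B \<otimes> B')"
    and par_TenA: "f \<in> Arr C \<Longrightarrow> g \<in> Arr C \<Longrightarrow> par f = par g \<Longrightarrow> par (f \<odot> g) = par f"
    and TenO_undefined: "\<not> (A \<in> Ob C \<and> B \<in> Ob C) \<Longrightarrow> A \<otimes> B = undefined"
    and TenA_undefined: "\<not> (f \<in> Arr C \<and> g \<in> Arr C \<and> par f = par g) \<Longrightarrow> f \<odot> g = undefined"
    and TenA_Id: "A \<in> Ob C \<Longrightarrow> B \<in> Ob C \<Longrightarrow> Id C A \<odot> Id C B = Id C (A \<otimes> B)"
    and interchange:
      "f \<in> hom C A B \<Longrightarrow> g \<in> hom C B E \<Longrightarrow> f' \<in> hom C A' B' \<Longrightarrow> g' \<in> hom C B' E' \<Longrightarrow>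
         par f = par f' \<Longrightarrow> par g = par g' \<Longrightarrow>
         (g \<cdot> f) \<odot> (g' \<cdot> f') = (g \<odot> g') \<cdot> (f \<odot> f')"
    and Assoc_hom:
      "A \<in> Ob C \<Longrightarrow> B \<in> Ob C \<Longrightarrow> E \<in> Ob C \<Longrightarrow>
         Assoc C A B E \<in> hom C ((A \<otimes> B) \<otimes> E) (A \<otimes> (B \<otimes> E)) \<and>
         is_iso C (Assoc C A B E) \<and> par (Assoc C A B E) = 0"
    and Lunit_hom:
      "A \<in> Ob C \<Longrightarrow>
         Lunit C A \<in> hom C (Unit C \<otimes> A) A \<and> is_iso C (Lunit C A) \<and> par (Lunit C A) = 0"
    and Runit_hom:
      "A \<in> Ob C \<Longrightarrow>
         Runit C A \<in> hom C (A \<otimes> Unit C) A \<and> is_iso C (Runit C A) \<and> par (Runit C A) = 0"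
    and Swap_hom:
      "A \<in> Ob C \<Longrightarrow> B \<in> Ob C \<Longrightarrow>
         Swap C A B \<in> hom C (A \<otimes> B) (B \<otimes> A) \<and> par (Swap C A B) = 0"
    and Assoc_undefined: "\<not> (A \<in> Ob C \<and> B \<in> Ob C \<and> E \<in> Ob C) \<Longrightarrow> Assoc C A B E = undefined"
    and Lunit_undefined: "A \<notin> Ob C \<Longrightarrow> Lunit C A = undefined"
    and Runit_undefined: "A \<notin> Ob C \<Longrightarrow> Runit C A = undefined"
    and Swap_undefined: "\<not> (A \<in> Ob C \<and> B \<in> Ob C) \<Longrightarrow> Swap C A B = undefined"
    and Assoc_natural:
      "f \<in> hom C A A' \<Longrightarrow> g \<in> hom C B B' \<Longrightarrow> h \<in> hom C E E' \<Longrightarrow> par f = par g \<Longrightarrow> par g = par h \<Longrightarrow>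
         Assoc C A' B' E' \<cdot> ((f \<odot> g) \<odot> h) = (f \<odot> (g \<odot> h)) \<cdot> Assoc C A B E"
    and Lunit_natural:
      "f \<in> hom C A B \<Longrightarrow> par f = 0 \<Longrightarrow> Lunit C B \<cdot> (Id C (Unit C) \<odot> f) = f \<cdot> Lunit C A"
    and Runit_natural:
      "f \<in> hom C A B \<Longrightarrow> par f = 0 \<Longrightarrow> Runit C B \<cdot> (f \<odot> Id C (Unit C)) = f \<cdot> Runit C A"
    and Swap_natural:
      "f \<in> hom C A A' \<Longrightarrow> g \<in> hom C B B' \<Longrightarrow> par f = par g \<Longrightarrow>
         Swap C A' B' \<cdot> (f \<odot> g) = (g \<odot> f) \<cdot> Swap C A B"
    and pentagon:
      "A \<in> Ob C \<Longrightarrow> B \<in> Ob C \<Longrightarrow> E \<in> Ob C \<Longrightarrow> F \<in> Ob C \<Longrightarrow>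
         (Id C A \<odot> Assoc C B E F) \<cdot> Assoc C A (B \<otimes> E) F \<cdot> (Assoc C A B E \<odot> Id C F) =
         Assoc C A B (E \<otimes> F) \<cdot> Assoc C (A \<otimes> B) E F"
    and triangle:
      "A \<in> Ob C \<Longrightarrow> B \<in> Ob C \<Longrightarrow>
         (Id C A \<odot> Lunit C B) \<cdot> Assoc C A (Unit C) B = Runit C A \<odot> Id C B"
    and Swap_Swap: "A \<in> Ob C \<Longrightarrow> B \<in> Ob C \<Longrightarrow> Swap C B A \<cdot> Swap C A B = Id C (A \<otimes> B)"
    and Swap_unit: "A \<in> Ob C \<Longrightarrow> Lunit C A \<cdot> Swap C A (Unit C) = Runit C A"
    and hexagon:
      "A \<in> Ob C \<Longrightarrow> B \<in> Ob C \<Longrightarrow> E \<in> Ob C \<Longrightarrow>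
         Assoc C B E A \<cdot> Swap C A (B \<otimes> E) \<cdot> Assoc C A B E =
         (Id C B \<odot> Swap C A E) \<cdot> Assoc C B A E \<cdot> (Swap C A B \<odot> Id C E)"

text \<open>
  \<open>id \<odot> swap \<odot> id\<close> with the suppressed associators made explicit:
  \<open>(A \<otimes> A) \<otimes> (B \<otimes> B) \<rightarrow> A \<otimes> (A \<otimes> (B \<otimes> B)) \<rightarrow> A \<otimes> ((A \<otimes> B) \<otimes> B) \<rightarrow> A \<otimes> ((B \<otimes> A) \<otimes> B)
  \<rightarrow> A \<otimes> (B \<otimes> (A \<otimes> B)) \<rightarrow> (A \<otimes> B) \<otimes> (A \<otimes> B)\<close>.
\<close>

definition middle_swap :: "('o, 'm, 'x) cd_data_scheme \<Rightarrow> 'o \<Rightarrow> 'o \<Rightarrow> 'm" where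
  "middle_swap C A B =
     Inverse C (Assoc C A B (A \<otimes>\<^bsub>C\<^esub> B)) \<cdot>\<^bsub>C\<^esub>
     (Id C A \<odot>\<^bsub>C\<^esub> Assoc C B A B) \<cdot>\<^bsub>C\<^esub>
     (Id C A \<odot>\<^bsub>C\<^esub> (Swap C A B \<odot>\<^bsub>C\<^esub> Id C B)) \<cdot>\<^bsub>C\<^esub>
     (Id C A \<odot>\<^bsub>C\<^esub> Inverse C (Assoc C A B B)) \<cdot>\<^bsub>C\<^esub>
     Assoc C A A (B \<otimes>\<^bsub>C\<^esub> B)"

text \<open>The part common to ICD-categories and quantum CD-categories.\<close>

locale comonoid_category = graded_symmetric_monoidal_category C par
  for C :: "('o, 'm, 'x) cd_data_scheme" (structure) and par :: "'m \<Rightarrow> bit" +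
  assumes Copy_hom: "A \<in> Ob C \<Longrightarrow> Copy C A \<in> hom C A (A \<otimes> A) \<and> par (Copy C A) = 0"
    and Del_hom: "A \<in> Ob C \<Longrightarrow> Del C A \<in> hom C A (Unit C) \<and> par (Del C A) = 0"
    and Copy_undefined: "A \<notin> Ob C \<Longrightarrow> Copy C A = undefined"
    and Del_undefined: "A \<notin> Ob C \<Longrightarrow> Del C A = undefined"
    and Copy_coassoc:
      "A \<in> Ob C \<Longrightarrow>
         Assoc C A A A \<cdot> (Copy C A \<odot> Id C A) \<cdot> Copy C A = (Id C A \<odot> Copy C A) \<cdot> Copy C A"
    and Copy_counit_left: "A \<in> Ob C \<Longrightarrow> Lunit C A \<cdot> (Del C A \<odot> Id C A) \<cdot> Copy C A = Id C A"
    and Copy_counit_right: "A \<in> Ob C \<Longrightarrow> Runit C A \<cdot> (Id C A \<odot> Del C A) \<cdot> Copy C A = Id C A"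
    and Copy_TenO:
      "A \<in> Ob C \<Longrightarrow> B \<in> Ob C \<Longrightarrow>
         Copy C (A \<otimes> B) = middle_swap C A B \<cdot> (Copy C A \<odot> Copy C B)"
    and Del_TenO:
      "A \<in> Ob C \<Longrightarrow> B \<in> Ob C \<Longrightarrow> Del C (A \<otimes> B) = Lunit C (Unit C) \<cdot> (Del C A \<odot> Del C B)"
    and Copy_Unit: "Copy C (Unit C) = Inverse C (Lunit C (Unit C))"
    and Del_Unit: "Del C (Unit C) = Id C (Unit C)"

record ('o, 'm) icd = "('o, 'm) cd_data" +
  Inv :: "'m \<Rightarrow> 'm"

locale icd_category = comonoid_category C "\<lambda>_. 0"
  for C :: "('o, 'm) icd" (structure) +
  assumes Inv_hom: "f \<in> hom C A B \<Longrightarrow> Inv C f \<in> hom C A B"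
    and Inv_undefined: "f \<notin> Arr C \<Longrightarrow> Inv C f = undefined"
    and Inv_Id: "A \<in> Ob C \<Longrightarrow> Inv C (Id C A) = Id C A"
    and Inv_Comp: "f \<in> hom C A B \<Longrightarrow> g \<in> hom C B E \<Longrightarrow> Inv C (g \<cdot> f) = Inv C g \<cdot> Inv C f"
    and Inv_TenA: "f \<in> Arr C \<Longrightarrow> g \<in> Arr C \<Longrightarrow> Inv C (f \<odot> g) = Inv C f \<odot> Inv C g"
    and Inv_Assoc:
      "A \<in> Ob C \<Longrightarrow> B \<in> Ob C \<Longrightarrow> E \<in> Ob C \<Longrightarrow> Inv C (Assoc C A B E) = Assoc C A B E"
    and Inv_Lunit: "A \<in> Ob C \<Longrightarrow> Inv C (Lunit C A) = Lunit C A"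
    and Inv_Runit: "A \<in> Ob C \<Longrightarrow> Inv C (Runit C A) = Runit C A"
    and Inv_Swap: "A \<in> Ob C \<Longrightarrow> B \<in> Ob C \<Longrightarrow> Inv C (Swap C A B) = Swap C A B"
    and Inv_Inv: "f \<in> Arr C \<Longrightarrow> Inv C (Inv C f) = f"
    and Inv_Copy: "A \<in> Ob C \<Longrightarrow> Inv C (Copy C A) = Swap C A A \<cdot> Copy C A"
    and Inv_Del: "A \<in> Ob C \<Longrightarrow> Inv C (Del C A) = Del C A"

text \<open>
  The arrows of a quantum CD-category form, literally, a disjoint union of even and odd ones: they
  are pairs consisting of the parity (\<open>0\<close> for even, \<open>1\<close> for odd) and an element of \<open>'m\<close>.
\<close>

record ('o, 'm) qcd = "('o, bit \<times> 'm) cd_data" +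
  Star :: "'o \<Rightarrow> bit \<times> 'm"

locale quantum_cd_category = comonoid_category C fst
  for C :: "('o, 'm) qcd" (structure) +
  assumes Star_hom: "A \<in> Ob C \<Longrightarrow> Star C A \<in> hom C A A \<and> fst (Star C A) = 1"
    and Star_undefined: "A \<notin> Ob C \<Longrightarrow> Star C A = undefined"
    and Copy_Star:
      "A \<in> Ob C \<Longrightarrow> Copy C A \<cdot> Star C A = Swap C A A \<cdot> (Star C A \<odot> Star C A) \<cdot> Copy C A"
    and Star_Star: "A \<in> Ob C \<Longrightarrow> Star C A \<cdot> Star C A = Id C A"
    and Star_TenO: "A \<in> Ob C \<Longrightarrow> B \<in> Ob C \<Longrightarrow> Star C (A \<otimes> B) = Star C A \<odot> Star C B"
    and Del_Star: "A \<in> Ob C \<Longrightarrow> Del C A \<cdot> Star C A = Star C (Unit C) \<cdot> Del C A"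

definition J :: "('o, 'm) qcd \<Rightarrow> ('o, 'm) icd" where
  "J C = (let X = Ob C; E = {f. (0, f) \<in> Arr C} in
    \<lparr> Ob = X,
      Arr = E,
      Dom = (\<lambda>f. if f \<in> E then Dom C (0, f) else undefined),
      Cod = (\<lambda>f. if f \<in> E then Cod C (0, f) else undefined),
      Id = (\<lambda>A. if A \<in> X then snd (Id C A) else undefined),
      Comp = (\<lambda>g f. if f \<in> E \<and> g \<in> E \<and> Cod C (0, f) = Dom C (0, g)
                    then snd ((0, g) \<cdot>\<^bsub>C\<^esub> (0, f)) else undefined),
      TenO = TenO C,
      TenA = (\<lambda>f g. if f \<in> E \<and> g \<in> E then snd ((0, f) \<odot>\<^bsub>C\<^esub> (0, g)) else undefined),
      Unit = Unit C,
      Assoc = (\<lambda>A B D. if A \<in> X \<and> B \<in> X \<and> D \<in> X then snd (Assoc C A B D) else undefined),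
      Lunit = (\<lambda>A. if A \<in> X then snd (Lunit C A) else undefined),
      Runit = (\<lambda>A. if A \<in> X then snd (Runit C A) else undefined),
      Swap = (\<lambda>A B. if A \<in> X \<and> B \<in> X then snd (Swap C A B) else undefined),
      Copy = (\<lambda>A. if A \<in> X then snd (Copy C A) else undefined),
      Del = (\<lambda>A. if A \<in> X then snd (Del C A) else undefined),
      Inv = (\<lambda>f. if f \<in> E
                 then snd (Star C (Cod C (0, f)) \<cdot>\<^bsub>C\<^esub> (0, f) \<cdot>\<^bsub>C\<^esub> Star C (Dom C (0, f)))
                 else undefined) \<rparr>)"

text \<open>
  Strict (symmetric) monoidal isomorphisms of quantum CD-categories, preserving the parity and
  also the copy, delete and \<open>*\<close> morphisms.  \<open>extensional\<close> only fixes the values of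
  the two maps outside the objects and arrows of \<open>C\<close>.
\<close>

definition strict_qcd_iso ::
  "('o, 'm) qcd \<Rightarrow> ('p, 'n) qcd \<Rightarrow> ('o \<Rightarrow> 'p) \<Rightarrow> (bit \<times> 'm \<Rightarrow> bit \<times> 'n) \<Rightarrow> bool" where
  "strict_qcd_iso C D Fo Fa \<longleftrightarrow>
     Fo \<in> extensional (Ob C) \<and> bij_betw Fo (Ob C) (Ob D) \<and>
     Fa \<in> extensional (Arr C) \<and> bij_betw Fa (Arr C) (Arr D) \<and>
     (\<forall>f\<in>Arr C. fst (Fa f) = fst f \<and> Dom D (Fa f) = Fo (Dom C f) \<and> Cod D (Fa f) = Fo (Cod C f)) \<and>
     (\<forall>A\<in>Ob C. Fa (Id C A) = Id D (Fo A)) \<and>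
     (\<forall>f\<in>Arr C. \<forall>g\<in>Arr C. Cod C f = Dom C g \<longrightarrow> Fa (g \<cdot>\<^bsub>C\<^esub> f) = Fa g \<cdot>\<^bsub>D\<^esub> Fa f) \<and>
     Fo (Unit C) = Unit D \<and>
     (\<forall>A\<in>Ob C. \<forall>B\<in>Ob C. Fo (A \<otimes>\<^bsub>C\<^esub> B) = Fo A \<otimes>\<^bsub>D\<^esub> Fo B) \<and>
     (\<forall>f\<in>Arr C. \<forall>g\<in>Arr C. fst f = fst g \<longrightarrow> Fa (f \<odot>\<^bsub>C\<^esub> g) = Fa f \<odot>\<^bsub>D\<^esub> Fa g) \<and>
     (\<forall>A\<in>Ob C. \<forall>B\<in>Ob C. \<forall>E\<in>Ob C. Fa (Assoc C A B E) = Assoc D (Fo A) (Fo B) (Fo E)) \<and>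
     (\<forall>A\<in>Ob C. Fa (Lunit C A) = Lunit D (Fo A) \<and> Fa (Runit C A) = Runit D (Fo A)) \<and>
     (\<forall>A\<in>Ob C. \<forall>B\<in>Ob C. Fa (Swap C A B) = Swap D (Fo A) (Fo B)) \<and>
     (\<forall>A\<in>Ob C. Fa (Copy C A) = Copy D (Fo A) \<and> Fa (Del C A) = Del D (Fo A) \<and>
               Fa (Star C A) = Star D (Fo A))"

text \<open>
  \<open>D\<close> and \<open>C\<close> are meant to have the same objects and the same even arrows, as \<open>Q (J C)\<close> and \<open>C\<close> do
  because of \<open>J (Q (J C)) = J C\<close>.  On odd arrows nothing is prescribed except
  that the isomorphism preserves the \<open>*\<close> morphisms.
\<close>

definition canonical_iso ::
  "('o, 'm) qcd \<Rightarrow> ('o, 'm) qcd \<Rightarrow> ('o \<Rightarrow> 'o) \<times> (bit \<times> 'm \<Rightarrow> bit \<times> 'm) \<Rightarrow> bool" where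
  "canonical_iso D C F \<longleftrightarrow>
     strict_qcd_iso D C (fst F) (snd F) \<and>
     (\<forall>A\<in>Ob D. fst F A = A) \<and>
     (\<forall>f\<in>Arr D. fst f = 0 \<longrightarrow> snd F f = f)"

end

theory Submission
  imports Defs
begin

text \<open>
  In a quantum CD-category every odd arrow \<open>h : A \<rightarrow> B\<close> is uniquely \<open>\<phi> *\<^sub>A\<close> with \<open>\<phi> = h *\<^sub>A\<close> even,
  because \<open>*\<^sub>A *\<^sub>A = id\<close>.  So the even arrows determine all arrows, and \<open>* \<phi> = (* \<phi> *) *\<close> shows that
  composition is determined by the even arrows together with the involution \<open>\<phi> \<mapsto> * \<phi> *\<close>.  It is
  therefore the multiplication of a crossed product with \<open>\<int>/2\<close>:
  \<open>(\<psi> *\<^sup>p) (\<phi> *\<^sup>q) = \<psi> \<phi>\<^sup>p *\<^bsup>p+q\<^esup>\<close>, where \<open>\<phi>\<^sup>p\<close> is \<open>\<phi>\<close> with the involution applied \<open>p\<close> times.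
  The tensor product only combines arrows of the same parity and, as \<open>*\<close> is
  monoidal, \<open>(\<phi> *\<^sup>p) \<odot> (\<psi> *\<^sup>p) = (\<phi> \<odot> \<psi>) *\<^sup>p\<close>.

  Conversely, these formulas turn any ICD-category \<open>C\<close> into a quantum CD-category, the
  crossed product \<open>crossed_product C\<close>.  Its axioms for arrows of parity \<open>p\<close>
  reduce to those of \<open>C\<close> because the involution is a strict symmetric monoidal functor, and
  \<open>copy * = swap (* \<odot> *) copy\<close> is the law \<open>Inv copy = swap copy\<close> in disguise.  Its even part is \<open>C\<close> itself,
  which is \<open>J_CP\<close>.  The canonical isomorphism from the crossed product of \<open>J C\<close> to \<open>C\<close> is
  \<open>(p, \<phi>) \<mapsto> \<phi> *\<^sup>p\<close>; it is unique because \<open>(1, \<phi>)\<close> is the composite of \<open>(0, \<phi>)\<close> with a \<open>*\<close> morphism,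
  and on both factors a canonical isomorphism is prescribed.

  That \<open>\<phi> \<mapsto> * \<phi> *\<close> is a strict symmetric monoidal functor is immediate from naturality, except for
  the unitors: these are natural only with respect to even arrows, so commutation with \<open>*\<close> is not an
  instance of naturality.  The lemma \<open>bar_Runit\<close> derives it from the counit laws instead.
\<close>

section \<open>Typing rules and inverses\<close>

context category
begin

lemma Dom_Ob [simp]: "f \<in> Arr C \<Longrightarrow> Dom C f \<in> Ob C"
  and Cod_Ob [simp]: "f \<in> Arr C \<Longrightarrow> Cod C f \<in> Ob C"
  by (rule Dom_closed Cod_closed; assumption)+

lemma Id_arr [simp]:
  assumes "A \<in> Ob C"
  shows "Id C A \<in> Arr C" "Dom C (Id C A) = A" "Cod C (Id C A) = A"
  using Id_hom[OF assms] by (auto simp: hom_def)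

lemma Comp_arr [simp]:
  assumes "f \<in> Arr C" "g \<in> Arr C" "Cod C f = Dom C g"
  shows "g \<cdot> f \<in> Arr C" "Dom C (g \<cdot> f) = Dom C f" "Cod C (g \<cdot> f) = Cod C g"
  using Comp_hom[of f "Dom C f" "Dom C g" g "Cod C g"] assms by (auto simp: hom_def)

lemma Comp_Id [simp]:
  assumes "f \<in> Arr C"
  shows "Cod C f = B \<Longrightarrow> Id C B \<cdot> f = f" "Dom C f = B \<Longrightarrow> f \<cdot> Id C B = f"
  using Comp_Id_left[of f "Dom C f" "Cod C f"] Comp_Id_right[of f "Dom C f" "Cod C f"] assms
  by (auto simp: hom_def)

lemma Comp_assoc_arr:
  assumes "f \<in> Arr C" "g \<in> Arr C" "h \<in> Arr C" "Cod C f = Dom C g" "Cod C g = Dom C h"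
  shows "(h \<cdot> g) \<cdot> f = h \<cdot> (g \<cdot> f)"
  using Comp_assoc[of f "Dom C f" "Dom C g" g "Dom C h" h "Cod C h"] assms
  by (auto simp: hom_def)

lemma inverse_arrows_unique:
  assumes "inverse_arrows C f g" "inverse_arrows C f h"
  shows "g = h"
proof -
  have "g = g \<cdot> (f \<cdot> h)"
    using assms by (auto simp: inverse_arrows_def hom_def)
  also have "\<dots> = (g \<cdot> f) \<cdot> h"
    using assms by (subst Comp_assoc_arr) (auto simp: inverse_arrows_def hom_def)
  also have "\<dots> = h"
    using assms by (auto simp: inverse_arrows_def hom_def)
  finally show ?thesis .
qed

lemma Inverse_eqI:
  assumes "inverse_arrows C f g"
  shows "Inverse C f = g"
  unfolding Inverse_def using assms inverse_arrows_unique by blast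

lemma inverse_arrows_Inverse:
  assumes "is_iso C f"
  shows "inverse_arrows C f (Inverse C f)"
  using assms Inverse_eqI by (auto simp: is_iso_def)

lemma Inverse_arr [simp]:
  assumes "is_iso C f"
  shows "Inverse C f \<in> Arr C" "Dom C (Inverse C f) = Cod C f" "Cod C (Inverse C f) = Dom C f"
  using inverse_arrows_Inverse[OF assms] by (auto simp: inverse_arrows_def hom_def)

end

context graded_symmetric_monoidal_category
begin

lemma Unit_Ob [simp]: "Unit C \<in> Ob C"
  and TenO_Ob [simp]: "A \<in> Ob C \<Longrightarrow> B \<in> Ob C \<Longrightarrow> A \<otimes> B \<in> Ob C"
  by (rule Unit_closed, rule TenO_closed)

lemma TenA_arr [simp]:
  assumes "f \<in> Arr C" "g \<in> Arr C" "par f = par g"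
  shows "f \<odot> g \<in> Arr C" "Dom C (f \<odot> g) = Dom C f \<otimes> Dom C g"
    "Cod C (f \<odot> g) = Cod C f \<otimes> Cod C g"
  using TenA_hom[of f "Dom C f" "Cod C f" g "Dom C g" "Cod C g"] assms
  by (auto simp: hom_def)

lemma par_Comp_arr:
  assumes "f \<in> Arr C" "g \<in> Arr C" "Cod C f = Dom C g"
  shows "par (g \<cdot> f) = par g + par f"
  using par_Comp[of f "Dom C f" "Dom C g" g "Cod C g"] assms by (auto simp: hom_def)

declare TenA_Id [simp]

lemma interchange_arr:
  assumes "f \<in> Arr C" "g \<in> Arr C" "f' \<in> Arr C" "g' \<in> Arr C"
    "Cod C f = Dom C g" "Cod C f' = Dom C g'" "par f = par f'" "par g = par g'"
  shows "(g \<cdot> f) \<odot> (g' \<cdot> f') = (g \<odot> g') \<cdot> (f \<odot> f')"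
  using interchange[of f "Dom C f" "Dom C g" g "Cod C g" f' "Dom C f'" "Dom C g'" g' "Cod C g'"] assms
  by (auto simp: hom_def)

lemma Assoc_arr [simp]:
  assumes "A \<in> Ob C" "B \<in> Ob C" "E \<in> Ob C"
  shows "Assoc C A B E \<in> Arr C" "Dom C (Assoc C A B E) = (A \<otimes> B) \<otimes> E"
    "Cod C (Assoc C A B E) = A \<otimes> (B \<otimes> E)" "is_iso C (Assoc C A B E)"
  using Assoc_hom[OF assms] by (auto simp: hom_def)

lemma Lunit_arr [simp]:
  assumes "A \<in> Ob C"
  shows "Lunit C A \<in> Arr C" "Dom C (Lunit C A) = Unit C \<otimes> A" "Cod C (Lunit C A) = A"
    "is_iso C (Lunit C A)"
  using Lunit_hom[OF assms] by (auto simp: hom_def)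

lemma Runit_arr [simp]:
  assumes "A \<in> Ob C"
  shows "Runit C A \<in> Arr C" "Dom C (Runit C A) = A \<otimes> Unit C" "Cod C (Runit C A) = A"
    "is_iso C (Runit C A)"
  using Runit_hom[OF assms] by (auto simp: hom_def)

lemma Swap_arr [simp]:
  assumes "A \<in> Ob C" "B \<in> Ob C"
  shows "Swap C A B \<in> Arr C" "Dom C (Swap C A B) = A \<otimes> B" "Cod C (Swap C A B) = B \<otimes> A"
  using Swap_hom[OF assms] by (auto simp: hom_def)

lemma par_structure:
  "A \<in> Ob C \<Longrightarrow> B \<in> Ob C \<Longrightarrow> E \<in> Ob C \<Longrightarrow> par (Assoc C A B E) = 0"
  "A \<in> Ob C \<Longrightarrow> par (Lunit C A) = 0"
  "A \<in> Ob C \<Longrightarrow> par (Runit C A) = 0"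
  "A \<in> Ob C \<Longrightarrow> B \<in> Ob C \<Longrightarrow> par (Swap C A B) = 0"
  using Assoc_hom Lunit_hom Runit_hom Swap_hom by blast+

lemma Assoc_natural_arr:
  assumes "f \<in> Arr C" "g \<in> Arr C" "h \<in> Arr C" "par f = par g" "par g = par h"
  shows "Assoc C (Cod C f) (Cod C g) (Cod C h) \<cdot> ((f \<odot> g) \<odot> h) =
    (f \<odot> (g \<odot> h)) \<cdot> Assoc C (Dom C f) (Dom C g) (Dom C h)"
  using assms by (intro Assoc_natural) (auto simp: hom_def)

lemma Swap_natural_arr:
  assumes "f \<in> Arr C" "g \<in> Arr C" "par f = par g"
  shows "Swap C (Cod C f) (Cod C g) \<cdot> (f \<odot> g) = (g \<odot> f) \<cdot> Swap C (Dom C f) (Dom C g)"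
  using assms by (intro Swap_natural) (auto simp: hom_def)

lemma Lunit_natural_arr:
  assumes "f \<in> Arr C" "par f = 0"
  shows "Lunit C (Cod C f) \<cdot> (Id C (Unit C) \<odot> f) = f \<cdot> Lunit C (Dom C f)"
  using assms by (intro Lunit_natural) (auto simp: hom_def)

lemma Runit_natural_arr:
  assumes "f \<in> Arr C" "par f = 0"
  shows "Runit C (Cod C f) \<cdot> (f \<odot> Id C (Unit C)) = f \<cdot> Runit C (Dom C f)"
  using assms by (intro Runit_natural) (auto simp: hom_def)

text \<open>
  Parity is a homomorphism to \<open>\<int>/2\<close>, where every element is its own inverse.  In particular, inverses
  of even arrows are even, so that they survive the restriction to even arrows.
\<close>

lemma inverse_arrows_par:
  assumes "inverse_arrows C f g"
  shows "par g = par f"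
proof -
  have "par g + par f = 0"
    using assms par_Comp_arr[of f g] par_Id[of "Dom C f"] by (auto simp: inverse_arrows_def hom_def)
  then show ?thesis by (metis add_bit_eq_xor add_right_cancel xor_self_eq)
qed

lemma par_Inverse: "is_iso C f \<Longrightarrow> par (Inverse C f) = par f"
  by (rule inverse_arrows_par, rule inverse_arrows_Inverse)

lemma middle_swap_arr [simp]:
  assumes "A \<in> Ob C" "B \<in> Ob C"
  shows "middle_swap C A B \<in> Arr C" "Dom C (middle_swap C A B) = (A \<otimes> A) \<otimes> (B \<otimes> B)"
    "Cod C (middle_swap C A B) = (A \<otimes> B) \<otimes> (A \<otimes> B)"
  using assms by (simp_all add: middle_swap_def par_Id par_Comp_arr par_TenA par_structure par_Inverse)

end

context comonoid_category
begin

lemma Copy_arr [simp]: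
  assumes "A \<in> Ob C"
  shows "Copy C A \<in> Arr C" "Dom C (Copy C A) = A" "Cod C (Copy C A) = A \<otimes> A"
  using Copy_hom[OF assms] by (auto simp: hom_def)

lemma Del_arr [simp]:
  assumes "A \<in> Ob C"
  shows "Del C A \<in> Arr C" "Dom C (Del C A) = A" "Cod C (Del C A) = Unit C"
  using Del_hom[OF assms] by (auto simp: hom_def)

lemma par_Copy_Del:
  "A \<in> Ob C \<Longrightarrow> par (Copy C A) = 0" "A \<in> Ob C \<Longrightarrow> par (Del C A) = 0"
  using Copy_hom Del_hom by blast+

end

section \<open>From quantum CD-categories to ICD-categories\<close>

definition even_arr :: "'m \<Rightarrow> bit \<times> 'm" where
  "even_arr f = (0, f)"

lemma fst_even [simp]: "fst (even_arr f) = 0"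
  by (simp add: even_arr_def)

lemma even_arr_snd [simp]: "fst f = 0 \<Longrightarrow> even_arr (snd f) = f"
  by (simp add: even_arr_def prod_eq_iff)

context quantum_cd_category
begin

text \<open>
  For the constant parity of an ICD-category these equations degenerate to \<open>0 = 0\<close> and
  \<open>0 = 0 + 0\<close>, which must not become rewrite rules; hence they are declared for \<open>fst\<close> only.
\<close>

declare par_Id [simp] par_Comp_arr [simp] par_TenA [simp] par_structure [simp] par_Inverse [simp]
  par_Copy_Del [simp]

lemma Star_arr [simp]:
  assumes "A \<in> Ob C"
  shows "Star C A \<in> Arr C" "Dom C (Star C A) = A" "Cod C (Star C A) = A" "fst (Star C A) = 1"
  using Star_hom[OF assms] by (auto simp: hom_def)

lemma Star_Star_Comp [simp]:
  assumes "f \<in> Arr C" "Cod C f = A"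
  shows "Star C A \<cdot> (Star C A \<cdot> f) = f"
  using assms Comp_assoc_arr[of f "Star C A" "Star C A"] by (auto simp: Star_Star)

text \<open>
  The involution of \<open>J C\<close> is the restriction of the following operation, which makes sense for arrows
  of both parities.
\<close>

definition bar :: "bit \<times> 'm \<Rightarrow> bit \<times> 'm" where
  "bar f = Star C (Cod C f) \<cdot> f \<cdot> Star C (Dom C f)"

lemma bar_arr [simp]:
  assumes "f \<in> Arr C"
  shows "bar f \<in> Arr C" "Dom C (bar f) = Dom C f" "Cod C (bar f) = Cod C f" "fst (bar f) = fst f"
  using assms by (auto simp: bar_def)

text \<open>
  \<open>bar f\<close> is the only arrow \<open>f'\<close> with \<open>f * = * f'\<close>.  This turns every naturality statement with respect to
  \<open>*\<close> into the statement that \<open>bar\<close> fixes a structure morphism.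
\<close>

lemma bar_eqI:
  assumes "f \<in> Arr C" "f' \<in> Arr C" "Dom C f = Dom C f'" "Cod C f = Cod C f'"
    and "f \<cdot> Star C (Dom C f) = Star C (Cod C f) \<cdot> f'"
  shows "bar f = f'"
  using assms by (simp add: bar_def Comp_assoc_arr)

lemma Star_Comp:
  assumes "f \<in> Arr C"
  shows "Star C (Cod C f) \<cdot> f = bar f \<cdot> Star C (Dom C f)"
  using assms by (simp add: bar_def Comp_assoc_arr Star_Star)

lemma Comp_Star:
  assumes "f \<in> Arr C"
  shows "f \<cdot> Star C (Dom C f) = Star C (Cod C f) \<cdot> bar f"
  using assms by (simp add: bar_def Comp_assoc_arr Star_Star)

lemma bar_bar [simp]: "f \<in> Arr C \<Longrightarrow> bar (bar f) = f"
  by (rule bar_eqI) (simp_all add: Star_Comp)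

lemma bar_Id [simp]: "A \<in> Ob C \<Longrightarrow> bar (Id C A) = Id C A"
  by (rule bar_eqI) simp_all

lemma bar_Comp:
  assumes "f \<in> Arr C" "g \<in> Arr C" "Cod C f = Dom C g"
  shows "bar (g \<cdot> f) = bar g \<cdot> bar f"
proof (rule bar_eqI)
  have "(g \<cdot> f) \<cdot> Star C (Dom C f) = g \<cdot> (Star C (Dom C g) \<cdot> bar f)"
    using assms by (simp add: Comp_assoc_arr Comp_Star)
  also have "\<dots> = (Star C (Cod C g) \<cdot> bar g) \<cdot> bar f"
    using assms by (simp flip: Comp_assoc_arr Comp_Star)
  also have "\<dots> = Star C (Cod C g) \<cdot> (bar g \<cdot> bar f)"
    using assms by (simp add: Comp_assoc_arr)
  finally show "(g \<cdot> f) \<cdot> Star C (Dom C (g \<cdot> f)) = Star C (Cod C (g \<cdot> f)) \<cdot> (bar g \<cdot> bar f)"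
    using assms by simp
qed (use assms in simp_all)

lemma bar_TenA:
  assumes "f \<in> Arr C" "g \<in> Arr C" "fst f = fst g"
  shows "bar (f \<odot> g) = bar f \<odot> bar g"
proof (rule bar_eqI)
  have "(f \<odot> g) \<cdot> (Star C (Dom C f) \<odot> Star C (Dom C g)) =
      (f \<cdot> Star C (Dom C f)) \<odot> (g \<cdot> Star C (Dom C g))"
    using assms by (simp add: interchange_arr)
  also have "\<dots> = (Star C (Cod C f) \<cdot> bar f) \<odot> (Star C (Cod C g) \<cdot> bar g)"
    using assms by (simp add: Comp_Star)
  also have "\<dots> = (Star C (Cod C f) \<odot> Star C (Cod C g)) \<cdot> (bar f \<odot> bar g)"
    using assms by (intro interchange_arr) simp_all
  finally show "(f \<odot> g) \<cdot> Star C (Dom C (f \<odot> g)) =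
      Star C (Cod C (f \<odot> g)) \<cdot> (bar f \<odot> bar g)"
    using assms by (simp add: Star_TenO)
qed (use assms in simp_all)

lemma bar_Assoc:
  assumes "A \<in> Ob C" "B \<in> Ob C" "E \<in> Ob C"
  shows "bar (Assoc C A B E) = Assoc C A B E"
  by (rule bar_eqI)
    (use assms Assoc_natural_arr[of "Star C A" "Star C B" "Star C E"] in \<open>simp_all add: Star_TenO\<close>)

lemma bar_Swap:
  assumes "A \<in> Ob C" "B \<in> Ob C"
  shows "bar (Swap C A B) = Swap C A B"
  by (rule bar_eqI)
    (use assms Swap_natural_arr[of "Star C A" "Star C B"] in \<open>simp_all add: Star_TenO\<close>)

lemma bar_Copy:
  assumes "A \<in> Ob C"
  shows "bar (Copy C A) = Swap C A A \<cdot> Copy C A"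
proof (rule bar_eqI)
  show "Copy C A \<cdot> Star C (Dom C (Copy C A)) = Star C (Cod C (Copy C A)) \<cdot> (Swap C A A \<cdot> Copy C A)"
    using assms Swap_natural_arr[of "Star C A" "Star C A"]
    by (simp add: Copy_Star Star_TenO flip: Comp_assoc_arr)
qed (use assms in simp_all)

lemma bar_Del: "A \<in> Ob C \<Longrightarrow> bar (Del C A) = Del C A"
  by (rule bar_eqI) (simp_all add: Del_Star)

text \<open>
  Applying \<open>bar\<close> to the left counit law exchanges the two outputs of \<open>Copy\<close>, and moving the
  swap through \<open>Del \<odot> Id\<close> and into the unitor gives
  \<open>bar (Runit A) \<cdot> (Id A \<odot> Del A) \<cdot> Copy A = Id A\<close>.  So \<open>bar (Runit A)\<close> and \<open>Runit A\<close> are both left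
  inverse to the same arrow.  Since \<open>Runit A\<close> is invertible, \<open>bar (Runit A)\<close> is an endomorphism of \<open>A\<close>
  after \<open>Runit A\<close>, and this endomorphism must be the identity.
\<close>

lemma bar_Runit:
  assumes A: "A \<in> Ob C"
  shows "bar (Runit C A) = Runit C A"
proof -
  let ?I = "Unit C" and ?d = "(Id C A \<odot> Del C A) \<cdot> Copy C A"
  define r where "r = Inverse C (Runit C A)"
  have r: "r \<in> Arr C" "Dom C r = A" "Cod C r = A \<otimes> ?I" "r \<cdot> Runit C A = Id C (A \<otimes> ?I)"
    using inverse_arrows_Inverse[of "Runit C A"] A
    by (auto simp: r_def inverse_arrows_def hom_def)
  have "Id C A = bar (Lunit C A \<cdot> (Del C A \<odot> Id C A) \<cdot> Copy C A)"
    using A by (simp add: Copy_counit_left)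
  also have "\<dots> = bar (Lunit C A) \<cdot> (Del C A \<odot> Id C A) \<cdot> (Swap C A A \<cdot> Copy C A)"
    using A by (simp add: bar_Comp bar_TenA bar_Del bar_Copy)
  also have "\<dots> = bar (Lunit C A) \<cdot> (((Del C A \<odot> Id C A) \<cdot> Swap C A A) \<cdot> Copy C A)"
    using A by (simp add: Comp_assoc_arr)
  also have "(Del C A \<odot> Id C A) \<cdot> Swap C A A = Swap C A ?I \<cdot> (Id C A \<odot> Del C A)"
    using A Swap_natural_arr[of "Id C A" "Del C A"] by simp
  also have "bar (Lunit C A) \<cdot> ((Swap C A ?I \<cdot> (Id C A \<odot> Del C A)) \<cdot> Copy C A) =
      (bar (Lunit C A) \<cdot> bar (Swap C A ?I)) \<cdot> ?d"
    using A by (simp add: Comp_assoc_arr bar_Swap)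
  also have "\<dots> = bar (Runit C A) \<cdot> ?d"
    using A by (simp add: Swap_unit flip: bar_Comp)
  finally have *: "bar (Runit C A) \<cdot> ?d = Id C A" ..
  have "bar (Runit C A) = bar (Runit C A) \<cdot> (r \<cdot> Runit C A)"
    using A r by simp
  also have "\<dots> = (bar (Runit C A) \<cdot> r) \<cdot> Runit C A"
    using A r(1-3) by (simp add: Comp_assoc_arr)
  finally have bar: "bar (Runit C A) = (bar (Runit C A) \<cdot> r) \<cdot> Runit C A" .
  have "Id C A = ((bar (Runit C A) \<cdot> r) \<cdot> Runit C A) \<cdot> ?d"
    using * bar by simp
  also have "\<dots> = (bar (Runit C A) \<cdot> r) \<cdot> (Runit C A \<cdot> (Id C A \<odot> Del C A) \<cdot> Copy C A)"
    using A r(1-3) by (simp add: Comp_assoc_arr)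
  also have "\<dots> = bar (Runit C A) \<cdot> r"
    using A r by (simp add: Copy_counit_right)
  finally show ?thesis
    using bar A by (metis Comp_Id(1) Runit_arr(1,3))
qed

lemma Lunit_eq_Runit_Swap:
  assumes "A \<in> Ob C"
  shows "Lunit C A = Runit C A \<cdot> Swap C (Unit C) A"
  using assms by (simp add: Comp_assoc_arr Swap_Swap flip: Swap_unit)

lemma bar_Lunit: "A \<in> Ob C \<Longrightarrow> bar (Lunit C A) = Lunit C A"
  by (simp add: Lunit_eq_Runit_Swap bar_Comp bar_Runit bar_Swap)

text \<open>
  The inclusion \<open>even_arr\<close> of \<open>J C\<close> into \<open>C\<close> is injective, commutes with all operations of the
  monoidal structure and takes the involution to \<open>bar\<close>.  So
  every equation between arrows of \<open>J C\<close> can be checked in \<open>C\<close>; the following lemma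
  translates the equation, and the simplification rules after it move the inclusion inwards.
\<close>

lemma eq_iff_even_arr: "f = (g :: 'm) \<longleftrightarrow> even_arr f = even_arr g"
  by (simp add: even_arr_def)

lemma J_sel [simp]:
  "Ob (J C) = Ob C" "Unit (J C) = Unit C" "TenO (J C) = TenO C"
  by (simp_all add: J_def Let_def)

lemma Arr_J [simp]: "f \<in> Arr (J C) \<longleftrightarrow> even_arr f \<in> Arr C"
  by (simp add: J_def Let_def even_arr_def)

lemma Dom_Cod_J [simp]:
  assumes "even_arr f \<in> Arr C"
  shows "Dom (J C) f = Dom C (even_arr f)" "Cod (J C) f = Cod C (even_arr f)"
  using assms by (simp_all add: J_def Let_def even_arr_def)

lemma even_J [simp]:
  "A \<in> Ob C \<Longrightarrow> even_arr (Id (J C) A) = Id C A"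
  "A \<in> Ob C \<Longrightarrow> B \<in> Ob C \<Longrightarrow> E \<in> Ob C \<Longrightarrow> even_arr (Assoc (J C) A B E) = Assoc C A B E"
  "A \<in> Ob C \<Longrightarrow> even_arr (Lunit (J C) A) = Lunit C A"
  "A \<in> Ob C \<Longrightarrow> even_arr (Runit (J C) A) = Runit C A"
  "A \<in> Ob C \<Longrightarrow> B \<in> Ob C \<Longrightarrow> even_arr (Swap (J C) A B) = Swap C A B"
  "A \<in> Ob C \<Longrightarrow> even_arr (Copy (J C) A) = Copy C A"
  "A \<in> Ob C \<Longrightarrow> even_arr (Del (J C) A) = Del C A"
  by (simp_all add: J_def Let_def)

lemma even_Comp_J [simp]:
  assumes "even_arr f \<in> Arr C" "even_arr g \<in> Arr C" "Cod C (even_arr f) = Dom C (even_arr g)"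
  shows "even_arr (g \<cdot>\<^bsub>J C\<^esub> f) = even_arr g \<cdot> even_arr f"
proof -
  have "g \<cdot>\<^bsub>J C\<^esub> f = snd (even_arr g \<cdot> even_arr f)"
    using assms by (simp add: J_def Let_def even_arr_def)
  then show ?thesis using assms by simp
qed

lemma even_TenA_J [simp]:
  assumes "even_arr f \<in> Arr C" "even_arr g \<in> Arr C"
  shows "even_arr (f \<odot>\<^bsub>J C\<^esub> g) = even_arr f \<odot> even_arr g"
proof -
  have "f \<odot>\<^bsub>J C\<^esub> g = snd (even_arr f \<odot> even_arr g)"
    using assms by (simp add: J_def Let_def even_arr_def)
  then show ?thesis using assms by simp
qed

lemma even_Inv_J [simp]:
  assumes "even_arr f \<in> Arr C"
  shows "even_arr (Inv (J C) f) = bar (even_arr f)"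
proof -
  have "Inv (J C) f = snd (bar (even_arr f))"
    using assms by (simp add: J_def Let_def even_arr_def bar_def)
  then show ?thesis using assms by simp
qed

lemma J_undefined [simp]:
  "A \<notin> Ob C \<Longrightarrow> Id (J C) A = undefined"
  "\<not> (even_arr f \<in> Arr C \<and> even_arr g \<in> Arr C) \<Longrightarrow> f \<odot>\<^bsub>J C\<^esub> g = undefined"
  "\<not> (A \<in> Ob C \<and> B \<in> Ob C \<and> E \<in> Ob C) \<Longrightarrow> Assoc (J C) A B E = undefined"
  "A \<notin> Ob C \<Longrightarrow> Lunit (J C) A = undefined"
  "A \<notin> Ob C \<Longrightarrow> Runit (J C) A = undefined"
  "\<not> (A \<in> Ob C \<and> B \<in> Ob C) \<Longrightarrow> Swap (J C) A B = undefined"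
  "A \<notin> Ob C \<Longrightarrow> Copy (J C) A = undefined"
  "A \<notin> Ob C \<Longrightarrow> Del (J C) A = undefined"
  "even_arr f \<notin> Arr C \<Longrightarrow> Inv (J C) f = undefined"
  by (auto simp: J_def Let_def even_arr_def)

lemma category_J: "category (J C)"
proof
  fix f g A B E
  show "f \<in> hom (J C) A B \<Longrightarrow> g \<in> hom (J C) B E \<Longrightarrow> g \<cdot>\<^bsub>J C\<^esub> f \<in> hom (J C) A E"
    by (auto simp: hom_def)
next
  fix f A B
  assume "f \<in> hom (J C) A B"
  then show "Id (J C) B \<cdot>\<^bsub>J C\<^esub> f = f" "f \<cdot>\<^bsub>J C\<^esub> Id (J C) A = f"
    by (auto simp: hom_def eq_iff_even_arr)
next
  fix f g h A B E F
  assume "f \<in> hom (J C) A B" "g \<in> hom (J C) B E" "h \<in> hom (J C) E F"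
  then show "(h \<cdot>\<^bsub>J C\<^esub> g) \<cdot>\<^bsub>J C\<^esub> f = h \<cdot>\<^bsub>J C\<^esub> (g \<cdot>\<^bsub>J C\<^esub> f)"
    by (auto simp: hom_def eq_iff_even_arr Comp_assoc_arr)
qed (auto simp: hom_def, auto simp: J_def Let_def even_arr_def)

lemma inverse_arrows_J:
  assumes "inverse_arrows C (even_arr f) g"
  shows "inverse_arrows (J C) f (snd g)"
proof -
  have "fst g = 0"
    using inverse_arrows_par[OF assms] by simp
  then show ?thesis
    using assms by (auto simp: inverse_arrows_def hom_def eq_iff_even_arr)
qed

lemma is_iso_J [simp]: "is_iso C (even_arr f) \<Longrightarrow> is_iso (J C) f"
  using inverse_arrows_J by (auto simp: is_iso_def)

lemma even_Inverse_J [simp]: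
  assumes "is_iso C (even_arr f)"
  shows "even_arr (Inverse (J C) f) = Inverse C (even_arr f)"
  using category.Inverse_eqI[OF category_J inverse_arrows_J[OF inverse_arrows_Inverse[OF assms]]]
    assms by simp

lemma even_middle_swap_J [simp]:
  assumes "A \<in> Ob C" "B \<in> Ob C"
  shows "even_arr (middle_swap (J C) A B) = middle_swap C A B"
  using assms by (simp add: middle_swap_def)

lemma graded_symmetric_monoidal_category_J:
  "graded_symmetric_monoidal_category (J C) (\<lambda>_. 0)"
proof (intro graded_symmetric_monoidal_category.intro category_J
    graded_symmetric_monoidal_category_axioms.intro)
qed (auto simp: hom_def eq_iff_even_arr TenO_undefined interchange_arr Assoc_natural_arr Lunit_natural_arr
    Runit_natural_arr Swap_natural_arr pentagon triangle Swap_Swap Swap_unit hexagon)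

lemma comonoid_category_J: "comonoid_category (J C) (\<lambda>_. 0)"
  by (intro comonoid_category.intro graded_symmetric_monoidal_category_J
      comonoid_category_axioms.intro)
    (auto simp: hom_def eq_iff_even_arr Copy_coassoc Copy_counit_left Copy_counit_right Copy_TenO
      Del_TenO Copy_Unit Del_Unit)

theorem icd_category_J: "icd_category (J C)"
  by (intro icd_category.intro comonoid_category_J icd_category_axioms.intro)
    (auto simp: hom_def eq_iff_even_arr bar_Comp bar_TenA bar_Assoc bar_Lunit bar_Runit bar_Swap
      bar_Copy bar_Del)

end

section \<open>From ICD-categories to quantum CD-categories\<close>

text \<open>
  A pair \<open>(p, f)\<close> stands for \<open>f *\<^sup>p\<close> with \<open>f\<close> placed after the power of \<open>*\<close>.  Moving a \<open>*\<close> past the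
  first arrow of a composite applies the involution to that arrow.
\<close>

definition crossed_product :: "('o, 'm) icd \<Rightarrow> ('o, 'm) qcd" where
  "crossed_product C = (let X = Ob C; E = Arr C in
    \<lparr> Ob = X,
      Arr = UNIV \<times> E,
      Dom = (\<lambda>f. Dom C (snd f)),
      Cod = (\<lambda>f. Cod C (snd f)),
      Id = (\<lambda>A. if A \<in> X then (0, Id C A) else undefined),
      Comp = (\<lambda>g f. if snd f \<in> E \<and> snd g \<in> E \<and> Cod C (snd f) = Dom C (snd g)
                    then (fst g + fst f,
                          snd g \<cdot>\<^bsub>C\<^esub> (if fst g = 0 then snd f else Inv C (snd f)))
                    else undefined),
      TenO = TenO C,
      TenA = (\<lambda>f g. if snd f \<in> E \<and> snd g \<in> E \<and> fst f = fst g
                    then (fst f, snd f \<odot>\<^bsub>C\<^esub> snd g) else undefined),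
      Unit = Unit C,
      Assoc = (\<lambda>A B D. if A \<in> X \<and> B \<in> X \<and> D \<in> X then (0, Assoc C A B D) else undefined),
      Lunit = (\<lambda>A. if A \<in> X then (0, Lunit C A) else undefined),
      Runit = (\<lambda>A. if A \<in> X then (0, Runit C A) else undefined),
      Swap = (\<lambda>A B. if A \<in> X \<and> B \<in> X then (0, Swap C A B) else undefined),
      Copy = (\<lambda>A. if A \<in> X then (0, Copy C A) else undefined),
      Del = (\<lambda>A. if A \<in> X then (0, Del C A) else undefined),
      Star = (\<lambda>A. if A \<in> X then (1, Id C A) else undefined) \<rparr>)"

context icd_category
begin

text \<open>
  The action of \<open>\<int>/2\<close> given by the involution.  With it both parities are treated uniformly: the
  axioms of the crossed product hold because each \<open>twist p\<close> is a strict symmetric monoidal functor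
  and \<open>twist\<close> is additive in \<open>p\<close>.
\<close>

definition twist :: "bit \<Rightarrow> 'm \<Rightarrow> 'm" where
  "twist p f = (if p = 0 then f else Inv C f)"

lemma Inv_arr [simp]:
  assumes "f \<in> Arr C"
  shows "Inv C f \<in> Arr C" "Dom C (Inv C f) = Dom C f" "Cod C (Inv C f) = Cod C f"
  using Inv_hom[of f "Dom C f" "Cod C f"] assms by (auto simp: hom_def)

lemma twist_arr [simp]:
  assumes "f \<in> Arr C"
  shows "twist p f \<in> Arr C" "Dom C (twist p f) = Dom C f" "Cod C (twist p f) = Cod C f"
  using assms by (simp_all add: twist_def)

lemma twist_0 [simp]: "twist 0 f = f"
  by (simp add: twist_def)

lemma twist_twist [simp]: "f \<in> Arr C \<Longrightarrow> twist p (twist q f) = twist (p + q) f"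
  by (cases p; cases q) (simp_all add: twist_def Inv_Inv)

lemma twist_Comp:
  assumes "f \<in> Arr C" "g \<in> Arr C" "Cod C f = Dom C g"
  shows "twist p (g \<cdot> f) = twist p g \<cdot> twist p f"
  using assms Inv_Comp[of f "Dom C f" "Dom C g" g "Cod C g"] by (simp add: twist_def hom_def)

lemma twist_TenA:
  "f \<in> Arr C \<Longrightarrow> g \<in> Arr C \<Longrightarrow> twist p (f \<odot> g) = twist p f \<odot> twist p g"
  by (simp add: twist_def Inv_TenA)

lemma twist_structure [simp]:
  "A \<in> Ob C \<Longrightarrow> twist p (Id C A) = Id C A"
  "A \<in> Ob C \<Longrightarrow> B \<in> Ob C \<Longrightarrow> E \<in> Ob C \<Longrightarrow> twist p (Assoc C A B E) = Assoc C A B E"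
  "A \<in> Ob C \<Longrightarrow> B \<in> Ob C \<Longrightarrow> twist p (Swap C A B) = Swap C A B"
  "A \<in> Ob C \<Longrightarrow> twist p (Del C A) = Del C A"
  by (simp_all add: twist_def Inv_Id Inv_Assoc Inv_Swap Inv_Del)

abbreviation CP :: "('o, 'm) qcd" where
  "CP \<equiv> crossed_product C"

lemma CP_sel [simp]:
  "Ob CP = Ob C" "Arr CP = UNIV \<times> Arr C" "Unit CP = Unit C" "TenO CP = TenO C"
  "Dom CP (p, f) = Dom C f" "Cod CP (p, f) = Cod C f"
  by (simp_all add: crossed_product_def Let_def)

lemma CP_structure [simp]:
  "A \<in> Ob C \<Longrightarrow> Id CP A = (0, Id C A)"
  "A \<in> Ob C \<Longrightarrow> B \<in> Ob C \<Longrightarrow> E \<in> Ob C \<Longrightarrow> Assoc CP A B E = (0, Assoc C A B E)"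
  "A \<in> Ob C \<Longrightarrow> Lunit CP A = (0, Lunit C A)"
  "A \<in> Ob C \<Longrightarrow> Runit CP A = (0, Runit C A)"
  "A \<in> Ob C \<Longrightarrow> B \<in> Ob C \<Longrightarrow> Swap CP A B = (0, Swap C A B)"
  "A \<in> Ob C \<Longrightarrow> Copy CP A = (0, Copy C A)"
  "A \<in> Ob C \<Longrightarrow> Del CP A = (0, Del C A)"
  "A \<in> Ob C \<Longrightarrow> Star CP A = (1, Id C A)"
  by (simp_all add: crossed_product_def Let_def)

lemma CP_Comp [simp]:
  assumes "f \<in> Arr C" "g \<in> Arr C" "Cod C f = Dom C g"
  shows "(p, g) \<cdot>\<^bsub>CP\<^esub> (q, f) = (p + q, g \<cdot> twist p f)"
  using assms by (simp add: crossed_product_def Let_def twist_def)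

lemma CP_TenA [simp]:
  assumes "f \<in> Arr C" "g \<in> Arr C"
  shows "(p, f) \<odot>\<^bsub>CP\<^esub> (p, g) = (p, f \<odot> g)"
  using assms by (simp add: crossed_product_def Let_def)

lemma CP_undefined:
  "f \<notin> Arr CP \<Longrightarrow> Dom CP f = undefined"
  "f \<notin> Arr CP \<Longrightarrow> Cod CP f = undefined"
  "A \<notin> Ob CP \<Longrightarrow> Id CP A = undefined"
  "\<not> (f \<in> Arr CP \<and> g \<in> Arr CP \<and> Cod CP f = Dom CP g) \<Longrightarrow> g \<cdot>\<^bsub>CP\<^esub> f = undefined"
  "\<not> (A \<in> Ob CP \<and> B \<in> Ob CP) \<Longrightarrow> A \<otimes>\<^bsub>CP\<^esub> B = undefined"
  "\<not> (f \<in> Arr CP \<and> g \<in> Arr CP \<and> fst f = fst g) \<Longrightarrow> f \<odot>\<^bsub>CP\<^esub> g = undefined"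
  "\<not> (A \<in> Ob CP \<and> B \<in> Ob CP \<and> E \<in> Ob CP) \<Longrightarrow> Assoc CP A B E = undefined"
  "A \<notin> Ob CP \<Longrightarrow> Lunit CP A = undefined"
  "A \<notin> Ob CP \<Longrightarrow> Runit CP A = undefined"
  "\<not> (A \<in> Ob CP \<and> B \<in> Ob CP) \<Longrightarrow> Swap CP A B = undefined"
  "A \<notin> Ob CP \<Longrightarrow> Copy CP A = undefined"
  "A \<notin> Ob CP \<Longrightarrow> Del CP A = undefined"
  "A \<notin> Ob CP \<Longrightarrow> Star CP A = undefined"
  by (auto simp: crossed_product_def Let_def mem_Times_iff Dom_undefined Cod_undefined
      TenO_undefined)

lemma category_CP: "category CP"
  by (intro category.intro CP_undefined) (auto simp: hom_def twist_Comp Comp_assoc_arr)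

lemma inverse_arrows_CP:
  assumes "inverse_arrows C f g"
  shows "inverse_arrows CP (0, f) (0, g)"
  using assms by (auto simp: inverse_arrows_def hom_def)

lemma is_iso_CP [simp]: "is_iso C f \<Longrightarrow> is_iso CP (0, f)"
  using inverse_arrows_CP by (auto simp: is_iso_def)

lemma Inverse_CP [simp]:
  assumes "is_iso C f"
  shows "Inverse CP (0, f) = (0, Inverse C f)"
  by (rule category.Inverse_eqI[OF category_CP inverse_arrows_CP[OF inverse_arrows_Inverse[OF assms]]])

lemma middle_swap_CP [simp]:
  assumes "A \<in> Ob C" "B \<in> Ob C"
  shows "middle_swap CP A B = (0, middle_swap C A B)"
  using assms by (simp add: middle_swap_def)

lemma graded_symmetric_monoidal_category_CP:
  "graded_symmetric_monoidal_category CP fst"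
proof (intro graded_symmetric_monoidal_category.intro category_CP
    graded_symmetric_monoidal_category_axioms.intro CP_undefined)
qed (auto simp: hom_def interchange_arr twist_TenA Assoc_natural_arr
    Lunit_natural_arr Runit_natural_arr Swap_natural_arr pentagon triangle Swap_Swap Swap_unit
    hexagon)

lemma comonoid_category_CP: "comonoid_category CP fst"
  by (intro comonoid_category.intro graded_symmetric_monoidal_category_CP
      comonoid_category_axioms.intro CP_undefined)
    (auto simp: hom_def Copy_coassoc Copy_counit_left Copy_counit_right Copy_TenO
      Del_TenO Copy_Unit Del_Unit)

text \<open>
  Composing with \<open>(1, Id A)\<close>, the \<open>*\<close> morphism of the crossed product, twists what precedes it, so this
  is \<open>swap (* \<odot> *) copy = copy *\<close> there.
\<close>

lemma Swap_Inv_Copy: "A \<in> Ob C \<Longrightarrow> Swap C A A \<cdot> twist 1 (Copy C A) = Copy C A"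
  by (simp add: twist_def Inv_Copy Swap_Swap flip: Comp_assoc_arr)

theorem quantum_cd_category_CP: "quantum_cd_category CP"
  by (intro quantum_cd_category.intro comonoid_category_CP quantum_cd_category_axioms.intro
      CP_undefined)
    (auto simp: hom_def Swap_Inv_Copy)

text \<open>
  The even arrows \<open>(0, f)\<close> compose and tensor as in \<open>C\<close>, and conjugating \<open>(0, f)\<close> with \<open>(1, Id A)\<close> gives
  \<open>(0, Inv C f)\<close>.  Equality of the operations outside their domain comes from the axioms that make them
  \<open>undefined\<close> there.
\<close>

theorem J_CP: "J CP = C"
proof (rule icd.equality)
  show "Inv (J CP) = Inv C"
    by (auto simp: J_def Let_def fun_eq_iff Inv_undefined Inv_Id twist_def)
qed (auto simp: J_def Let_def fun_eq_iff Dom_undefined Cod_undefined Id_undefined Comp_undefined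
    TenA_undefined Assoc_undefined Lunit_undefined Runit_undefined Swap_undefined Copy_undefined
    Del_undefined)

end

section \<open>The canonical isomorphism\<close>

context quantum_cd_category
begin

sublocale J: icd_category "J C"
  by (rule icd_category_J)

text \<open>The power \<open>*\<^sup>p\<close>.\<close>

definition star :: "bit \<Rightarrow> 'o \<Rightarrow> bit \<times> 'm" where
  "star p A = (if p = 0 then Id C A else Star C A)"

lemma star_arr [simp]:
  assumes "A \<in> Ob C"
  shows "star p A \<in> Arr C" "Dom C (star p A) = A" "Cod C (star p A) = A" "fst (star p A) = p"
  using assms by (simp_all add: star_def)

lemma star_0 [simp]: "star 0 A = Id C A"
  by (simp add: star_def)

lemma star_1 [simp]: "star 1 A = Star C A"
  by (simp add: star_def)

lemma star_star [simp]: "A \<in> Ob C \<Longrightarrow> star p A \<cdot> star q A = star (p + q) A"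
  by (cases p; cases q) (simp_all add: Star_Star)

lemma star_TenO: "A \<in> Ob C \<Longrightarrow> B \<in> Ob C \<Longrightarrow> star p (A \<otimes> B) = star p A \<odot> star p B"
  by (cases p) (simp_all add: Star_TenO)

text \<open>The commutation rule on which the multiplication of the crossed product is modelled.\<close>

lemma star_Comp_even:
  assumes "even_arr f \<in> Arr C"
  shows "star p (Cod C (even_arr f)) \<cdot> even_arr f =
    even_arr (J.twist p f) \<cdot> star p (Dom C (even_arr f))"
  using assms by (cases p) (simp_all add: J.twist_def Star_Comp)

text \<open>
  Evaluation of the formal pairs of the crossed product in \<open>C\<close>, restricted to the arrows because
  isomorphisms are extensional maps.
\<close>

definition untwist :: "bit \<times> 'm \<Rightarrow> bit \<times> 'm" where
  "untwist = (\<lambda>f\<in>Arr J.CP. even_arr (snd f) \<cdot> star (fst f) (Dom C (even_arr (snd f))))"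

lemma untwist:
  assumes "even_arr f \<in> Arr C"
  shows "untwist (p, f) = even_arr f \<cdot> star p (Dom C (even_arr f))"
  using assms by (simp add: untwist_def)

lemma untwist_arr [simp]:
  assumes "even_arr f \<in> Arr C"
  shows "untwist (p, f) \<in> Arr C" "Dom C (untwist (p, f)) = Dom C (even_arr f)"
    "Cod C (untwist (p, f)) = Cod C (even_arr f)" "fst (untwist (p, f)) = p"
  using assms by (simp_all add: untwist)

lemma even_arr_twist_arr [simp]:
  assumes "even_arr f \<in> Arr C"
  shows "even_arr (J.twist p f) \<in> Arr C"
    "Dom C (even_arr (J.twist p f)) = Dom C (even_arr f)"
    "Cod C (even_arr (J.twist p f)) = Cod C (even_arr f)"
  using assms by (simp_all add: J.twist_def)

lemma untwist_Comp:
  assumes "even_arr f \<in> Arr C" "even_arr g \<in> Arr C" "Cod C (even_arr f) = Dom C (even_arr g)"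
  shows "untwist ((p, g) \<cdot>\<^bsub>J.CP\<^esub> (q, f)) = untwist (p, g) \<cdot> untwist (q, f)"
proof -
  let ?g = "even_arr g" and ?f = "even_arr f" and ?f' = "even_arr (J.twist p f)"
  have "untwist (p, g) \<cdot> untwist (q, f) = ?g \<cdot> ((star p (Dom C ?g) \<cdot> ?f) \<cdot> star q (Dom C ?f))"
    using assms by (simp add: untwist Comp_assoc_arr)
  also have "star p (Dom C ?g) \<cdot> ?f = ?f' \<cdot> star p (Dom C ?f)"
    using assms star_Comp_even[of f p] by simp
  also have "?g \<cdot> ((?f' \<cdot> star p (Dom C ?f)) \<cdot> star q (Dom C ?f)) =
      (?g \<cdot> ?f') \<cdot> star (p + q) (Dom C ?f)"
    using assms by (simp add: Comp_assoc_arr)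
  also have "\<dots> = untwist ((p, g) \<cdot>\<^bsub>J.CP\<^esub> (q, f))"
    using assms by (simp add: untwist)
  finally show ?thesis ..
qed

lemma untwist_TenA:
  assumes "even_arr f \<in> Arr C" "even_arr g \<in> Arr C"
  shows "untwist ((p, f) \<odot>\<^bsub>J.CP\<^esub> (p, g)) = untwist (p, f) \<odot> untwist (p, g)"
  using assms by (simp add: untwist star_TenO interchange_arr)

text \<open>
  Since \<open>*\<^sup>p\<close> is its own inverse, composing an arrow \<open>h\<close> of parity \<open>p\<close> with \<open>*\<^sup>p\<close> recovers its even factor.
\<close>

lemma untwist_bij: "bij_betw untwist (Arr J.CP) (Arr C)"
proof (rule bij_betwI)
  define retwist where "retwist h = (fst h, snd (h \<cdot> star (fst h) (Dom C h)))" for h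
  have even: "even_arr (snd (h \<cdot> star (fst h) (Dom C h))) = h \<cdot> star (fst h) (Dom C h)"
    if "h \<in> Arr C" for h
    using that by simp
  show "untwist \<in> Arr J.CP \<rightarrow> Arr C"
    by auto
  show "retwist \<in> Arr C \<rightarrow> Arr J.CP"
    by (auto simp: retwist_def even simp del: even_arr_snd)
  show "retwist (untwist f) = f" if f: "f \<in> Arr J.CP" for f
  proof (cases f)
    case (Pair p e)
    then show ?thesis
      using f by (simp add: retwist_def) (simp add: untwist Comp_assoc_arr, simp add: even_arr_def)
  qed
  show "untwist (retwist h) = h" if h: "h \<in> Arr C" for h
    using h by (simp add: retwist_def untwist even Comp_assoc_arr)
qed

lemma canonical_iso_untwist:
  "canonical_iso J.CP C (\<lambda>A\<in>Ob C. A, untwist)"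
proof -
  have "strict_qcd_iso J.CP C (\<lambda>A\<in>Ob C. A) untwist"
    unfolding strict_qcd_iso_def
  proof (intro conjI)
    show "bij_betw (\<lambda>A\<in>Ob C. A) (Ob J.CP) (Ob C)"
      by (simp add: bij_betw_def inj_on_def)
    show "untwist \<in> extensional (Arr J.CP)"
      unfolding untwist_def by (rule restrict_extensional)
    show "bij_betw untwist (Arr J.CP) (Arr C)"
      by (rule untwist_bij)
    show "\<forall>f\<in>Arr J.CP. \<forall>g\<in>Arr J.CP. Cod J.CP f = Dom J.CP g \<longrightarrow>
        untwist (g \<cdot>\<^bsub>J.CP\<^esub> f) = untwist g \<cdot> untwist f"
      by (auto simp: untwist_Comp simp del: J.CP_Comp)
    show "\<forall>f\<in>Arr J.CP. \<forall>g\<in>Arr J.CP. fst f = fst g \<longrightarrow>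
        untwist (f \<odot>\<^bsub>J.CP\<^esub> g) = untwist f \<odot> untwist g"
      by (auto simp: untwist_TenA simp del: J.CP_TenA)
  qed (auto simp: untwist)
  then show ?thesis
    by (auto simp: canonical_iso_def untwist) (simp add: even_arr_def)
qed

text \<open>
  An odd arrow \<open>(1, f)\<close> of the crossed product is \<open>(0, f) \<cdot> Star A\<close>; a canonical isomorphism sends the
  first factor to itself and the second one to the \<open>*\<close> morphism of \<open>C\<close>.
\<close>

lemma canonical_iso_unique:
  assumes F: "canonical_iso J.CP C F"
  shows "F = (\<lambda>A\<in>Ob C. A, untwist)"
proof (rule prod_eqI)
  have iso: "strict_qcd_iso J.CP C (fst F) (snd F)"
    and Ob: "\<And>A. A \<in> Ob C \<Longrightarrow> fst F A = A"
    and ev: "\<And>f. even_arr f \<in> Arr C \<Longrightarrow> snd F (0, f) = even_arr f"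
    using F by (auto simp: canonical_iso_def even_arr_def)
  show "fst F = fst (\<lambda>A\<in>Ob C. A, untwist)"
    using iso Ob by (auto simp: strict_qcd_iso_def extensional_def restrict_def)
  have F_Comp: "snd F (g \<cdot>\<^bsub>J.CP\<^esub> f) = snd F g \<cdot> snd F f"
    if "f \<in> Arr J.CP" "g \<in> Arr J.CP" "Cod J.CP f = Dom J.CP g" for f g
    using iso that unfolding strict_qcd_iso_def by blast
  have F_untwist: "snd F (p, f) = untwist (p, f)" if f: "even_arr f \<in> Arr C" for p f
  proof (cases "p = 0")
    case True
    then show ?thesis
      using f ev[OF f] by (simp add: untwist)
  next
    case False
    let ?A = "Dom C (even_arr f)"
    have "snd F ((0, f) \<cdot>\<^bsub>J.CP\<^esub> Star J.CP ?A) = snd F (0, f) \<cdot> snd F (Star J.CP ?A)"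
      using f by (intro F_Comp) simp_all
    moreover have "snd F (Star J.CP ?A) = Star C ?A"
      using iso f Ob by (simp add: strict_qcd_iso_def)
    ultimately show ?thesis
      using f ev[OF f] False by (simp add: untwist)
  qed
  have "snd F \<in> extensional (Arr J.CP)"
    using iso by (simp add: strict_qcd_iso_def)
  moreover have "untwist \<in> extensional (Arr J.CP)"
    by (simp add: untwist_def)
  ultimately show "snd F = snd (\<lambda>A\<in>Ob C. A, untwist)"
    by (auto intro!: extensionalityI[where A = "Arr J.CP"] simp: F_untwist)
qed

end

theorem theorem2p22:
  shows "(\<forall>C' :: ('o, 'm) qcd. quantum_cd_category C' \<longrightarrow> icd_category (J C')) \<and>
    (\<exists>Q :: ('o, 'm) icd \<Rightarrow> ('o, 'm) qcd.
       (\<forall>C. icd_category C \<longrightarrow> quantum_cd_category (Q C)) \<and>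
       (\<forall>C. icd_category C \<longrightarrow> J (Q C) = C) \<and>
       (\<forall>C'. quantum_cd_category C' \<longrightarrow> (\<exists>!F. canonical_iso (Q (J C')) C' F)))"
proof (intro conjI exI[of _ crossed_product] allI impI)
  fix C' :: "('o, 'm) qcd"
  assume "quantum_cd_category C'"
  then interpret quantum_cd_category C' .
  show "icd_category (J C')"
    by (rule icd_category_J)
  show "\<exists>!F. canonical_iso (crossed_product (J C')) C' F"
    using canonical_iso_untwist canonical_iso_unique by blast
next
  fix C :: "('o, 'm) icd"
  assume "icd_category C"
  then interpret icd_category C .
  show "quantum_cd_category (crossed_product C)" "J (crossed_product C) = C"
    by (rule quantum_cd_category_CP, rule J_CP)
qed

end
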